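(* Any inflated probability function (distribution) $P:\mathbf{F}\to[0,m]$, with set $\Omega$ of elementary events, is a complete rigid positive probability structure (with universe of events $U=\Omega$ and scale $X=[0,m]$ with the natural order of the real numbers).
   Context: Inflated probability. $\Omega$ is a finite set of elementary events $w_i$, where an elementary event may carry a multiplicity $n_i$ (so that $\Omega$ is then a multiset); $\mathbf{F}$ is a collection of subsets of $\Omega$, called events. A set algebra is a collection of sets closed under union, intersection and difference. An inflated probability function is a function $P:\mathbf{F}\to[0,m]$, with $m$ a natural number and scale the real interval $[0,m]$, characterized by mathematical axioms and by informal physical axioms. Mathematical axioms: (AS) $\mathbf{F}$ is a set algebra that has $\Omega$ as its element; (UP) $0\le P(\Omega)\le m$ for some natural number $m$; (LP) $P(\emptyset)=0$; (FA) $P(A\cup B)=P(A)+P(B)$ for all $A,B\in\mathbf{F}$ with $A\cap B\equiv\emptyset$ (i.e. $A$ and $B$ disjoint). Physical axioms and conditions (about trials): an event $A$ occurs in a trial if and only if some elementary event from $A$ occurs in it (Decomposability); the number of occurrences of an elementary event $w_i$ from $A$ in one trial cannot be larger than its multiplicity $n_i$ in $\Omega$ (Boundary); in any trial at least one elementary event occurs (Occurrence); in any sequence of trials there is only a finite number of trials when at least one elementary event does not occur (Finite Occurrence); in any sequence of trials there are infinitely many trials when at least one elementary event occurs (Infinite Occurrence); in any sequence of trials there is only a finite number of trials when an elementary event from $A$ occurs (Finite Occurrence Condition); in each trial exactly one elementary event happens (Outcome); in each trial elementary events of only one type happen, and their number cannot be larger than the multiplicity of this element in the multiset $\Omega$ (Single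 Type). The source states that, since probability structures are characterized only by mathematical axioms, only the mathematical axioms of inflated probability are needed for this result. Positive probability structure. Let $U$ be a finite set (the universe of events) and $\mathbf{F}$ a family of subsets of $U$ with $U\in\mathbf{F}$ that is a Boolean algebra, or a set algebra, or a set field in $U$ (a set algebra closed under complements); elements of $\mathbf{F}$ are called permissible events. Let $X$ (the scale) be a set with a strict partial order $\succ$; $a\succcurlyeq b$ means $a\succ b$ or $a=b$. A mapping $P:\mathbf{F}\to X$ is a positive probability structure if: (PNA) if $U\ne\emptyset$, then $P(U)\succ P(\emptyset)$; (ICA) for all $A,B\in\mathbf{F}$, if $A\supseteq B$, then $P(A)\succcurlyeq P(B)$; (PAA) for all $A,B,C\in\mathbf{F}$ with $A\cap C=B\cap C=\emptyset$: $P(A)\succ P(B)\Leftrightarrow P(A\cup C)\succ P(B\cup C)$. It is rigid if for all $A,B,C\in\mathbf{F}$ with $A\cap C=B\cap C=\emptyset$: $P(A)=P(B)\Leftrightarrow P(A\cup C)=P(B\cup C)$. It is complete if $\succ$ is a total strict order on the image of $\mathbf{F}$ under $P$.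
   Formalization: The formal theorem adds that, when Ω is nonempty, P is not identically zero on F; the zero function satisfies all the mathematical axioms of inflated probability but violates PNA, so the claim fails without this. *)

theory Defs
  imports "HOL-Analysis.Sigma_Algebra"
begin

definition set_algebra :: "'w set set \<Rightarrow> bool" where
  "set_algebra F \<longleftrightarrow>
     (\<forall>A\<in>F. \<forall>B\<in>F. A \<union> B \<in> F \<and> A \<inter> B \<in> F \<and> A - B \<in> F)"

definition set_field :: "'w set \<Rightarrow> 'w set set \<Rightarrow> bool" where
  "set_field U F \<longleftrightarrow> set_algebra F \<and> (\<forall>A\<in>F. U - A \<in> F)"

text \<open>
  A Boolean algebra of subsets of \<open>U\<close> is the library's \<^const>\<open>algebra\<close>.

  Set functions are total on the type \<open>'w set\<close>; only their values on the family \<open>F\<close> matter.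
\<close>

locale positive_probability_structure =
  fixes U :: "'w set" and F :: "'w set set"
    and X :: "'x set" and gt :: "'x \<Rightarrow> 'x \<Rightarrow> bool" (infix "\<succ>" 50)
    and P :: "'w set \<Rightarrow> 'x"
  assumes finite_universe: "finite U"
    and events_subset: "F \<subseteq> Pow U"
    and universe_event: "U \<in> F"
    and events_algebra: "algebra U F \<or> set_algebra F \<or> set_field U F"
    and scale_irrefl: "irreflp_on X (\<succ>)"
    and scale_trans: "transp_on X (\<succ>)"
    and maps_to_scale: "P \<in> F \<rightarrow> X"
    and PNA: "U \<noteq> {} \<Longrightarrow> P U \<succ> P {}"
    and ICA: "\<lbrakk>A \<in> F; B \<in> F; A \<supseteq> B\<rbrakk> \<Longrightarrow> P A \<succ> P B \<or> P A = P B"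
    and PAA: "\<lbrakk>A \<in> F; B \<in> F; C \<in> F; A \<inter> C = {}; B \<inter> C = {}\<rbrakk>
                \<Longrightarrow> P A \<succ> P B \<longleftrightarrow> P (A \<union> C) \<succ> P (B \<union> C)"

locale rigid_positive_probability_structure = positive_probability_structure +
  assumes rigid: "\<lbrakk>A \<in> F; B \<in> F; C \<in> F; A \<inter> C = {}; B \<inter> C = {}\<rbrakk>
                    \<Longrightarrow> P A = P B \<longleftrightarrow> P (A \<union> C) = P (B \<union> C)"

locale complete_positive_probability_structure = positive_probability_structure +
  assumes image_irrefl: "irreflp_on (P ` F) (\<succ>)"
    and image_trans: "transp_on (P ` F) (\<succ>)"
    and image_total: "totalp_on (P ` F) (\<succ>)"

locale complete_rigid_positive_probability_structure =
  rigid_positive_probability_structure + complete_positive_probability_structure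

text \<open>
  The mathematical axioms of inflated probability. Multiplicities of elementary events occur
  only in the physical axioms, about trials; events are sets of elementary events, so here
  \<open>\<Omega>\<close> is the underlying finite set.
\<close>

locale inflated_probability =
  fixes \<Omega> :: "'w set" and F :: "'w set set" and m :: nat and P :: "'w set \<Rightarrow> real"
  assumes finite_elementary: "finite \<Omega>"
    and events_subset: "F \<subseteq> Pow \<Omega>"
    and maps_to_scale: "P \<in> F \<rightarrow> {0..real m}"
    and AS: "set_algebra F \<and> \<Omega> \<in> F"
    and UP: "0 \<le> P \<Omega> \<and> P \<Omega> \<le> real m"
    and LP: "P {} = 0"
    and FA: "\<lbrakk>A \<in> F; B \<in> F; A \<inter> B = {}\<rbrakk> \<Longrightarrow> P (A \<union> B) = P A + P B"

text \<open>
  The mathematical axioms admit the zero function, which violates PNA as soon as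
  \<open>\<Omega>\<close> is nonempty. This is why a result deriving PNA has to exclude it.
\<close>

lemma zero_inflated_probability:
  assumes "finite \<Omega>"
  shows "inflated_probability \<Omega> (Pow \<Omega>) m (\<lambda>_. 0)"
  using assms by unfold_locales (auto simp: set_algebra_def)

lemma zero_not_positive_probability_structure:
  assumes "\<Omega> \<noteq> {}"
  shows "\<not> positive_probability_structure \<Omega> F {0..real m} (>) (\<lambda>_. 0 :: real)"
  using assms positive_probability_structure.PNA[of \<Omega> F "{0..real m}" "(>)" "\<lambda>_. 0"] by auto

end

theory Submission
  imports Defs
begin

text \<open>
  The one substantial point is monotonicity. A set algebra is closed under differences, so
  for \<open>B \<subseteq> A\<close> finite additivity splits \<open>P A\<close> as \<open>P B + P (A - B)\<close>, and values of \<open>P\<close>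
  are nonnegative. This is ICA. Applied to \<open>A \<subseteq> \<Omega>\<close> for an event of nonzero, hence positive,
  value, it gives \<open>P \<Omega> > 0 = P {}\<close>, which is PNA. For \<open>C\<close> disjoint from \<open>A\<close> and \<open>B\<close>, finite
  additivity adds the same number \<open>P C\<close> to both \<open>P A\<close> and \<open>P B\<close>; translation of the reals
  preserves and reflects \<open>>\<close> and \<open>=\<close>, which gives PAA and rigidity. Completeness is the
  linearity of the real order.
\<close>

lemma (in inflated_probability) mono:
  assumes "A \<in> F" "B \<in> F" "B \<subseteq> A"
  shows "P B \<le> P A"
proof -
  have diff: "A - B \<in> F"
    using AS assms by (auto simp: set_algebra_def)
  have "P A = P (B \<union> (A - B))"
    using \<open>B \<subseteq> A\<close> by (simp add: Un_absorb1)
  also have "\<dots> = P B + P (A - B)"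
    using FA[OF \<open>B \<in> F\<close> diff] by simp
  finally show ?thesis
    using maps_to_scale diff by auto
qed

theorem theorem2p3:
  fixes \<Omega> :: "'w set" and F :: "'w set set" and m :: nat and P :: "'w set \<Rightarrow> real"
  assumes "inflated_probability \<Omega> F m P"
    and nonzero: "\<Omega> \<noteq> {} \<Longrightarrow> \<exists>A\<in>F. P A \<noteq> 0"
  shows "complete_rigid_positive_probability_structure \<Omega> F {0..real m} (>) P"
proof -
  interpret inflated_probability \<Omega> F m P by fact
  show ?thesis
  proof unfold_locales
    show "P \<Omega> > P {}" if nonempty: "\<Omega> \<noteq> {}"
    proof -
      obtain A where A: "A \<in> F" "P A \<noteq> 0"
        using nonzero[OF nonempty] by blast
      have "0 < P A"
        using A maps_to_scale by (force simp: Pi_iff)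
      also have "P A \<le> P \<Omega>"
        using A(1) AS events_subset by (intro mono) auto
      finally show ?thesis
        by (simp add: LP)
    qed
  next
    fix A B
    assume "A \<in> F" "B \<in> F" "A \<supseteq> B"
    then show "P A > P B \<or> P A = P B"
      using mono[of A B] by linarith
  next
    fix A B C
    assume "A \<in> F" "B \<in> F" "C \<in> F" "A \<inter> C = {}" "B \<inter> C = {}"
    then have "P (A \<union> C) = P A + P C" "P (B \<union> C) = P B + P C"
      by (simp_all add: FA)
    then show "P A > P B \<longleftrightarrow> P (A \<union> C) > P (B \<union> C)"
      and "P A = P B \<longleftrightarrow> P (A \<union> C) = P (B \<union> C)"
      by simp_all
  qed (use finite_elementary events_subset AS maps_to_scale in
      \<open>auto simp: irreflp_on_def transp_on_def totalp_on_def\<close>)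
qed

end
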